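(* For all $n \ge 3$, $N_{1,2}(n) = 1$.
   Context: For positive integers $a<b$ and $n \ge 3$, an $(a,b)$-necklace of length $n$ is a circular arrangement of the integers $0,1,\ldots,n-1$ (each used exactly once) such that any two adjacent entries have difference $\pm a$ or $\pm b$. Two necklaces are considered the same if one is obtained from the other by rotation or reflection. $N_{a,b}(n)$ denotes the number of distinct $(a,b)$-necklaces of length $n$; equivalently, it is the number of Hamiltonian cycles (as undirected subgraphs) of the graph on $\{0,1,\ldots,n-1\}$ in which $x,y$ are adjacent if and only if $|x-y| \in \{a,b\}$. *)

theory Defs
  imports Main
begin

text \<open>A circular arrangement is represented by the list of its entries, read off from some starting
  point in one of the two directions; the last entry is adjacent to the first. Hence one necklace is
  an equivalence class of such lists under rotation and reversal. The definitions are meant for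
  \<open>0 < a\<close>, \<open>a < b\<close> and \<open>n \<ge> 3\<close>.\<close>

definition necklace_lists :: "nat \<Rightarrow> nat \<Rightarrow> nat \<Rightarrow> nat list set" where
  "necklace_lists a b n =
     {xs. distinct xs \<and> set xs = {0..<n} \<and>
          (\<forall>i<n. \<bar>int (xs ! i) - int (xs ! (Suc i mod n))\<bar> \<in> {int a, int b})}"

definition same_necklace :: "'a list \<Rightarrow> 'a list \<Rightarrow> bool" where
  "same_necklace xs ys \<longleftrightarrow> (\<exists>k. ys = rotate k xs \<or> ys = rotate k (rev xs))"

definition necklace_rel :: "nat \<Rightarrow> nat \<Rightarrow> nat \<Rightarrow> (nat list \<times> nat list) set" where
  "necklace_rel a b n =
     {(xs, ys). xs \<in> necklace_lists a b n \<and> ys \<in> necklace_lists a b n \<and> same_necklace xs ys}"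

definition necklaces :: "nat \<Rightarrow> nat \<Rightarrow> nat \<Rightarrow> nat list set set" where
  "necklaces a b n = necklace_lists a b n // necklace_rel a b n"

definition num_necklaces :: "nat \<Rightarrow> nat \<Rightarrow> nat \<Rightarrow> nat" where
  "num_necklaces a b n = card (necklaces a b n)"

lemma rotate_inverse: "\<exists>j. rotate j (rotate k xs) = xs"
proof -
  have "rotate (length xs * k - k) (rotate k xs) = xs"
  proof (cases "xs = []")
    case False
    then have "k \<le> length xs * k" by (cases xs) auto
    then have "rotate (length xs * k - k) (rotate k xs) = rotate (length xs * k) xs"
      by (simp add: rotate_rotate)
    also have "\<dots> = xs" by (simp add: rotate_id)
    finally show ?thesis .
  qed simp
  then show ?thesis by blast
qed

lemma rev_rotate_exists: "\<exists>j. rev (rotate k xs) = rotate j (rev xs)"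
proof (induction k)
  case 0
  have "rev (rotate 0 xs) = rotate 0 (rev xs)" by simp
  then show ?case by blast
next
  case (Suc k)
  then obtain j where j: "rev (rotate k xs) = rotate j (rev xs)" by blast
  let ?z = "rev (rotate1 (rotate k xs))"
  have 1: "rotate 1 ?z = rotate j (rev xs)"
    by (subst j[symmetric]) (cases "rotate k xs"; simp)
  obtain i where "rotate i (rotate 1 ?z) = ?z" using rotate_inverse by blast
  then have "?z = rotate (i + j) (rev xs)" by (simp only: 1 rotate_rotate)
  then show ?case by auto
qed

lemma same_necklace_refl: "same_necklace xs xs"
  unfolding same_necklace_def by (metis rotate0 id_apply)

lemma same_necklace_sym: "same_necklace xs ys \<Longrightarrow> same_necklace ys xs"
  unfolding same_necklace_def by (metis rotate_inverse rev_rotate_exists rev_rev_ident)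

lemma same_necklace_trans:
  "same_necklace xs ys \<Longrightarrow> same_necklace ys zs \<Longrightarrow> same_necklace xs zs"
  unfolding same_necklace_def by (metis rotate_rotate rev_rotate_exists rev_rev_ident)

lemma equiv_necklace_rel: "equiv (necklace_lists a b n) (necklace_rel a b n)"
  by (rule equivI)
     (auto simp: necklace_rel_def refl_on_def sym_def trans_def
        intro: same_necklace_refl same_necklace_sym same_necklace_trans)

end

(* Deleting 0 from a necklace leaves a Hamiltonian path from 1 to 2 on the remaining numbers, because
   1 and 2 are the only possible neighbours of 0. Cutting the necklace next to 0 instead gives a
   Hamiltonian path from 0 to 1. Such a path on more than two vertices cannot step from 0 to its
   endpoint 1, so it steps to 2; dropping 0, reversing and shifting by one gives a path of the same
   kind on one vertex fewer. Induction shows that the path is unique. *)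
theory Submission
  imports Defs
begin

definition link :: "nat \<Rightarrow> nat \<Rightarrow> bool" where
  "link x y \<longleftrightarrow> \<bar>int x - int y\<bar> \<in> {1, 2}"

lemma link_sym: "link x y \<longleftrightarrow> link y x"
  unfolding link_def by (simp add: abs_minus_commute)

lemma link_Suc [simp]: "link (Suc x) (Suc y) \<longleftrightarrow> link x y"
  unfolding link_def by simp

lemma link_0: "link 0 y \<longleftrightarrow> y = 1 \<or> y = 2"
  unfolding link_def by auto

text \<open>Reversing a list swaps the arguments of the relation under \<open>successively\<close>;
  symmetry of \<open>link\<close> undoes the swap.\<close>

lemma successively_link_flip [simp]:
  "successively (\<lambda>x y. link y x) xs \<longleftrightarrow> successively link xs"
  by (simp only: link_sym)

lemma successively_link_map_Suc [simp]:
  "successively link (map Suc xs) \<longleftrightarrow> successively link xs"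
  by (simp add: successively_map)

text \<open>Repeating the head at the end turns the cyclic condition with its \<open>mod\<close>
  into a linear one, open to the rules for \<open>successively\<close>.\<close>

lemma necklace_lists_1_2_iff:
  assumes "n > 0"
  shows "xs \<in> necklace_lists 1 2 n \<longleftrightarrow>
    distinct xs \<and> set xs = {0..<n} \<and> successively link (xs @ [hd xs])"
proof -
  have "(\<forall>i<n. \<bar>int (xs ! i) - int (xs ! (Suc i mod n))\<bar> \<in> {int 1, int 2})
      \<longleftrightarrow> successively link (xs @ [hd xs])"
    if "distinct xs" "set xs = {0..<n}"
  proof -
    have len: "length xs = n" using that distinct_card by fastforce
    have "(xs @ [hd xs]) ! i = xs ! i" "(xs @ [hd xs]) ! Suc i = xs ! (Suc i mod n)" if "i < n" for i
    proof -
      show "(xs @ [hd xs]) ! i = xs ! i" using that len by (simp add: nth_append)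
      show "(xs @ [hd xs]) ! Suc i = xs ! (Suc i mod n)"
      proof (cases "Suc i = n")
        case True
        then have "xs \<noteq> []" "Suc i = length xs" using len by auto
        then show ?thesis using True by (simp add: nth_append hd_conv_nth)
      qed (use that len in \<open>simp add: nth_append\<close>)
    qed
    then show ?thesis using len by (auto simp: successively_conv_nth link_def)
  qed
  then show ?thesis unfolding necklace_lists_def by blast
qed

lemma hd_neq_last:
  assumes "distinct xs" "length xs \<ge> 2"
  shows "hd xs \<noteq> last xs"
  using assms by (cases xs) (auto split: if_splits)

text \<open>Fixing both ends removes the freedom of rotation and reflection, so uniqueness is plain
  equality of lists.\<close>

definition ham_path_0_1 :: "nat \<Rightarrow> nat list \<Rightarrow> bool" where
  "ham_path_0_1 n xs \<longleftrightarrow>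
     distinct xs \<and> set xs = {0..<n} \<and> successively link xs \<and> hd xs = 0 \<and> last xs = 1"

text \<open>As an equivalence, this carries existence and uniqueness through one induction. It fails
  for \<open>n = 1\<close>: \<open>[0, 1]\<close> would need \<open>[0]\<close> to end in 1.\<close>

lemma ham_path_0_1_Suc:
  assumes "n \<ge> 2"
  shows "ham_path_0_1 (Suc n) xs \<longleftrightarrow> (\<exists>ys. xs = 0 # map Suc (rev ys) \<and> ham_path_0_1 n ys)"
proof
  assume xs: "ham_path_0_1 (Suc n) xs"
  then obtain zs where zs: "xs = 0 # zs"
    by (cases xs) (auto simp: ham_path_0_1_def)
  have "0 \<notin> set zs" using xs zs by (auto simp: ham_path_0_1_def)
  then obtain ws where ws: "zs = map Suc ws"
    by (metis ex_map_conv not0_implies_Suc)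
  have "set zs = {0..<Suc n} - {0}"
    using xs zs \<open>0 \<notin> set zs\<close> by (auto simp: ham_path_0_1_def)
  then have "Suc ` set ws = Suc ` {0..<n}"
    unfolding ws atLeast0_lessThan_Suc_eq_insert_0 by auto
  then have set: "set ws = {0..<n}" by (simp only: inj_image_eq_iff[OF inj_Suc])
  then have ne: "ws \<noteq> []" using assms by auto
  have dist: "distinct ws" using xs zs ws by (auto simp: ham_path_0_1_def distinct_map)
  have last: "last ws = 0" using xs zs ws ne by (auto simp: ham_path_0_1_def last_map)
  have "hd ws = 0 \<or> hd ws = 1"
    using xs zs ws ne by (cases ws) (auto simp: ham_path_0_1_def link_0)
  \<comment> \<open>This excludes stepping from 0 to 1 in \<open>xs\<close>: \<open>ws\<close> has
    at least two distinct entries, and its last one is already 0.\<close>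
  moreover have "hd ws \<noteq> 0"
    using hd_neq_last[OF dist] last set assms distinct_card[OF dist] by simp
  ultimately have "ham_path_0_1 n (rev ws)"
    using xs zs ws set dist last ne
    by (auto simp: ham_path_0_1_def hd_rev last_rev successively_Cons)
  then show "\<exists>ys. xs = 0 # map Suc (rev ys) \<and> ham_path_0_1 n ys"
    using zs ws by (intro exI[of _ "rev ws"]) simp
next
  assume "\<exists>ys. xs = 0 # map Suc (rev ys) \<and> ham_path_0_1 n ys"
  then obtain ys where ys: "xs = 0 # map Suc (rev ys)" "ham_path_0_1 n ys" by blast
  then have "ys \<noteq> []" using assms by (auto simp: ham_path_0_1_def)
  then show "ham_path_0_1 (Suc n) xs"
    using ys unfolding ham_path_0_1_def
    by (auto simp: successively_Cons distinct_map hd_map hd_rev last_map last_rev link_0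
        atLeast0_lessThan_Suc_eq_insert_0)
qed

lemma ham_path_0_1_unique_exists:
  assumes "n \<ge> 2"
  shows "\<exists>!xs. ham_path_0_1 n xs"
  using assms
proof (induction n rule: dec_induct)
  case base
  have "ham_path_0_1 2 xs \<longleftrightarrow> xs = [0, 1]" for xs
  proof
    assume xs: "ham_path_0_1 2 xs"
    then have "length xs = 2" using distinct_card[of xs] by (simp add: ham_path_0_1_def)
    then show "xs = [0, 1]"
      using xs by (auto simp: ham_path_0_1_def numeral_2_eq_2 length_Suc_conv)
  qed (auto simp: ham_path_0_1_def link_def)
  then show ?case by simp
next
  case (step n)
  then show ?case unfolding ham_path_0_1_Suc[OF step.hyps(1)] by blast
qed

text \<open>The ends 1 and 0 differ by 1, so the path closes up to a circle.\<close>

lemma ham_path_0_1_imp_necklace_list: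
  assumes "n \<ge> 2" "ham_path_0_1 n xs"
  shows "xs \<in> necklace_lists 1 2 n"
  using assms
  by (subst necklace_lists_1_2_iff)
    (auto simp: ham_path_0_1_def successively_append_iff link_sym[of _ 0] link_0)

lemma necklace_list_same_ham_path_0_1:
  assumes "n \<ge> 3" "xs \<in> necklace_lists 1 2 n"
  shows "\<exists>ys. ham_path_0_1 n ys \<and> same_necklace xs ys"
proof -
  have xs: "distinct xs" "set xs = {0..<n}" "successively link (xs @ [hd xs])"
    using assms necklace_lists_1_2_iff[of n xs] by simp_all
  have "0 \<in> set xs" using xs assms by simp
  then obtain us vs where split: "xs = us @ 0 # vs" by (meson split_list)
  define zs where "zs = vs @ us"
  have rot: "rotate (length us) xs = 0 # zs" by (simp add: split zs_def rotate_append)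
  have dist: "distinct (0 # zs)" and set: "set (0 # zs) = {0..<n}"
    using xs(1,2) by (simp_all flip: rot)
  \<comment> \<open>The closing link of \<open>xs\<close> becomes the link from
    \<open>0 # vs\<close> to \<open>us @ [0]\<close>. The case split covers empty pieces:
    \<open>hd xs\<close> is 0 if \<open>us\<close> is empty.\<close>
  have succ: "successively link (0 # zs @ [0])"
    using xs(3) unfolding split zs_def
    by (cases us; cases vs) (auto simp: successively_append_iff successively_Cons hd_append)
  have len: "length zs \<ge> 2" using dist set assms distinct_card[of "0 # zs"] by simp
  then have ne: "zs \<noteq> []" by auto
  \<comment> \<open>The two neighbours of 0 on the circle differ, so they are 1 and 2 in some order;
    the order decides whether a reflection is needed.\<close>
  have "hd zs \<noteq> last zs"
    using hd_neq_last[of zs] len dist by simp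
  moreover have "hd zs \<in> {1, 2}" "last zs \<in> {1, 2}"
    using succ ne by (auto simp: successively_Cons successively_append_iff link_0 link_sym[of _ 0])
  ultimately consider "last zs = 1" | "hd zs = 1" by auto
  then show ?thesis
  proof cases
    case 1
    then have "ham_path_0_1 n (0 # zs)"
      using dist set succ ne
      by (auto simp: ham_path_0_1_def successively_Cons successively_append_iff)
    then show ?thesis using rot unfolding same_necklace_def by metis
  next
    case 2
    then have "ham_path_0_1 n (0 # rev zs)"
      using dist set succ ne
      by (auto simp: ham_path_0_1_def successively_Cons successively_append_iff last_rev hd_rev
          link_sym[of _ 0])
    moreover have "same_necklace (0 # zs) (0 # rev zs)"
    proof -
      \<comment> \<open>Reversal moves 0 to the end; rotating past \<open>rev zs\<close> brings it
        back to the front.\<close>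
      have "rotate (length (rev zs)) (rev (0 # zs)) = 0 # rev zs"
        by (simp only: rev.simps rotate_append) simp
      then show ?thesis unfolding same_necklace_def by metis
    qed
    moreover have "same_necklace xs (0 # zs)" using rot unfolding same_necklace_def by metis
    ultimately show ?thesis using same_necklace_trans by blast
  qed
qed

theorem mainTheorem3:
  fixes n :: nat
  assumes "n \<ge> 3"
  shows "num_necklaces 1 2 n = 1"
proof -
  let ?L = "necklace_lists 1 2 n" and ?R = "necklace_rel 1 2 n"
  from assms obtain p where p: "ham_path_0_1 n p" "\<And>ys. ham_path_0_1 n ys \<Longrightarrow> ys = p"
    using ham_path_0_1_unique_exists[of n] by auto
  have pL: "p \<in> ?L" using ham_path_0_1_imp_necklace_list p(1) assms by simp
  have "(xs, p) \<in> ?R" if "xs \<in> ?L" for xs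
    using necklace_list_same_ham_path_0_1[OF assms that] p(2) that pL
    unfolding necklace_rel_def by auto
  then have "?R `` {xs} = ?R `` {p}" if "xs \<in> ?L" for xs
    using that equiv_class_eq[OF equiv_necklace_rel] by blast
  \<comment> \<open>All classes coincide with that of \<open>p\<close>, and \<open>pL\<close>
    ensures that there is one.\<close>
  then have "necklaces 1 2 n = {?R `` {p}}"
    using pL unfolding necklaces_def quotient_def by blast
  then show ?thesis unfolding num_necklaces_def by simp
qed

end
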